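(* Let $n\ge 1$ and $\nu>n$ be integers with $n\equiv \nu \pmod 2$. Then the minimum number of edges of an $n$-factor-critical graph on $\nu$ vertices is exactly $\nu(n+1)/2$.
   Context: All graphs are finite, connected and simple. A graph $G$ on $\nu$ vertices is $n$-factor-critical, where $0\le n\le \nu-2$, if $G-S$ has a perfect matching for every $S\subseteq V(G)$ with $|S|=n$. (Note that $\nu>n$ together with $\nu\equiv n \pmod 2$ gives $\nu\ge n+2$.) *)

theory Defs
  imports "Graph_Theory.Graph_Theory"
begin

text \<open>
  Following \<^theory>\<open>Graph_Theory.Digraph\<close>, a finite simple graph is a finite symmetric digraph
  without loops and parallel arcs (locale \<^locale>\<open>graph\<close>). Each undirected edge is thus
  represented by two opposite arcs; \<open>uedges G\<close> is the set of undirected edges.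
\<close>

definition uedges :: "('a, 'b) pre_digraph \<Rightarrow> 'a set set" where
  "uedges G = {{tail G e, head G e} | e. e \<in> arcs G}"

definition perfect_matching :: "('a, 'b) pre_digraph \<Rightarrow> 'a set set \<Rightarrow> bool" where
  "perfect_matching G M \<longleftrightarrow>
     M \<subseteq> uedges G \<and> (\<forall>e\<in>M. \<forall>f\<in>M. e \<noteq> f \<longrightarrow> e \<inter> f = {}) \<and> \<Union>M = verts G"

text \<open>
  The bound \<open>n + 2 \<le> card (verts G)\<close> is \<open>n \<le> \<nu> - 2\<close> without truncated subtraction. The name
  \<open>connected\<close> is qualified because it also denotes topological connectedness.
\<close>

definition factor_critical :: "nat \<Rightarrow> ('a, 'b) pre_digraph \<Rightarrow> bool" where
  "factor_critical n G \<longleftrightarrow>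
     graph G \<and> Digraph_Component.connected G \<and> n + 2 \<le> card (verts G) \<and>
     (\<forall>S. S \<subseteq> verts G \<and> card S = n \<longrightarrow>
        (\<exists>M. perfect_matching (G \<restriction> (verts G - S)) M))"

end

theory Submission
  imports Defs
begin

text \<open>
  A vertex of degree at most \<open>n\<close> could be isolated by deleting \<open>n\<close> other vertices, so every degree is
  at least \<open>n + 1\<close>. The bound is attained by the Harary graphs: vertices on a cycle, joined when at
  distance at most \<open>k\<close>, together with all diameters if \<open>n = 2 k\<close> is even. The remaining vertices, taken
  in cyclic order, can only be interrupted at a deleted block of length \<open>k\<close>; for \<open>n = 2 k - 1\<close> there
  is at most one such block, so a Hamiltonian path survives. For \<open>n = 2\<close> another cubic graph is needed.
\<close>

section \<open>Vertex sets with a perfect matching\<close>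

text \<open>Perfect matchings are built pair by pair on bare vertex sets, so no set of edges has to
  be carried along. One orientation of each matched pair suffices, hence \<open>E\<close> may be any
  relation.\<close>

inductive matchable :: "('a \<Rightarrow> 'a \<Rightarrow> bool) \<Rightarrow> 'a set \<Rightarrow> bool" for E where
  empty: "matchable E {}"
| insert: "matchable E W \<Longrightarrow> E x y \<Longrightarrow> x \<noteq> y \<Longrightarrow> x \<notin> W \<Longrightarrow> y \<notin> W \<Longrightarrow>
    matchable E (insert x (insert y W))"

lemma matchable_Un:
  assumes "matchable E W" and "matchable E W'" and "W \<inter> W' = {}"
  shows "matchable E (W \<union> W')"
  using assms by (induction rule: matchable.induct) (auto intro: matchable.insert)

lemma matchable_image:
  assumes "matchable E W" and "inj_on f W"
    and "\<And>x y. x \<in> W \<Longrightarrow> y \<in> W \<Longrightarrow> x \<noteq> y \<Longrightarrow> E x y \<Longrightarrow> E' (f x) (f y)"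
  shows "matchable E' (f ` W)"
  using assms
proof (induction rule: matchable.induct)
  case (insert W x y)
  have "matchable E' (insert (f x) (insert (f y) (f ` W)))"
    using insert.hyps insert.prems by (intro matchable.insert insert.IH) auto
  then show ?case by simp
qed (simp add: matchable.empty)

lemma matchable_pairing:
  assumes "finite I" and "\<And>i. i \<in> I \<Longrightarrow> E i (f i)" and "inj_on f I" and "I \<inter> f ` I = {}"
  shows "matchable E (I \<union> f ` I)"
  using assms
proof (induction I rule: finite_induct)
  case (insert i I)
  have "matchable E (I \<union> f ` I)" using insert by (intro insert.IH) auto
  then have "matchable E (insert i (insert (f i) (I \<union> f ` I)))"
    using insert.prems insert.hyps by (intro matchable.insert) auto
  then show ?case by (simp add: insert_commute)
qed (simp add: matchable.empty)

lemma matchable_pair: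
  assumes "E x y" and "x \<noteq> y"
  shows "matchable E {x, y}"
  using matchable.insert[OF matchable.empty, of E x y] assms by simp

text \<open>Listed in increasing order, \<open>W\<close> is a Hamiltonian path with an even number of vertices.\<close>

lemma matchable_if_consecutive_adjacent:
  fixes W :: "nat set"
  assumes "finite W" and "even (card W)"
    and "\<And>x y. x \<in> W \<Longrightarrow> y \<in> W \<Longrightarrow> x < y \<Longrightarrow> W \<inter> {x<..<y} = {} \<Longrightarrow> E x y"
  shows "matchable E W"
  using assms
proof (induction "card W" arbitrary: W rule: less_induct)
  case less
  show ?case
  proof (cases "W = {}")
    case False
    define x where "x = Min W"
    have x: "x \<in> W" "\<And>z. z \<in> W \<Longrightarrow> x \<le> z"
      using False less.prems by (auto simp: x_def)
    have ne: "W - {x} \<noteq> {}"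
      using x(1) less.prems(2) by (metis card.empty card_Suc_Diff1 less.prems(1) odd_one One_nat_def)
    define y where "y = Min (W - {x})"
    have y: "y \<in> W" "x \<noteq> y" "\<And>z. z \<in> W - {x} \<Longrightarrow> y \<le> z"
      using Min_in[of "W - {x}"] ne less.prems by (auto simp: y_def)
    have xy: "x < y" using x y by (metis le_neq_implies_less)
    let ?R = "W - {x} - {y}"
    have c2: "card W = Suc (Suc (card ?R))"
      using x y less.prems(1)
      by (metis card_Suc_Diff1 finite_Diff insert_Diff insert_iff)
    \<comment> \<open>The two least elements are matched with each other. Both lie below all of
      \<open>?R\<close>, so consecutive elements of \<open>?R\<close> are also consecutive in
      \<open>W\<close>.\<close>
    have "matchable E ?R"
    proof (rule less.hyps)
      fix a b assume ab: "a \<in> ?R" "b \<in> ?R" "a < b" "?R \<inter> {a<..<b} = {}"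
      have "x \<le> a" "y \<le> a" using ab(1) x(2) y(3) by auto
      then have "W \<inter> {a<..<b} = {}" using ab(4) by auto
      then show "E a b" using ab less.prems(3) by auto
    qed (use c2 less.prems in auto)
    moreover have "E x y"
    proof (rule less.prems(3))
      have "z \<in> W \<Longrightarrow> z = x \<or> y \<le> z" for z using y(3)[of z] by auto
      then show "W \<inter> {x<..<y} = {}" by fastforce
    qed (use x y xy in auto)
    ultimately have "matchable E (insert x (insert y ?R))"
      using y(2) by (intro matchable.insert) auto
    moreover have "insert x (insert y ?R) = W" using x y by auto
    ultimately show ?thesis by simp
  qed (simp add: matchable.empty)
qed

section \<open>Harary graphs\<close>

text \<open>The circulant graph on the residues modulo \<open>N\<close> with jump set
  \<open>J\<close>. The jumps \<open>{1..k}\<close> give the Harary graphs of even degree; the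
  further jump \<open>h\<close> for \<open>N = 2 * h\<close> adds the diameters.\<close>

definition circulant :: "nat \<Rightarrow> nat set \<Rightarrow> nat \<Rightarrow> nat \<Rightarrow> bool" where
  "circulant N J x y \<longleftrightarrow> (\<exists>j\<in>J. y = (x + j) mod N \<or> x = (y + j) mod N)"

lemma circulant_if_diff:
  assumes "x < y" and "y < N" and "y - x \<in> J"
  shows "circulant N J x y"
  unfolding circulant_def using assms by (intro bexI[of _ "y - x"] disjI1) auto

lemma circulant_rotate:
  assumes "circulant N J x y"
  shows "circulant N J ((c + x) mod N) ((c + y) mod N)"
proof -
  obtain j where j: "j \<in> J" "y = (x + j) mod N \<or> x = (y + j) mod N"
    using assms by (auto simp: circulant_def)
  then have "(c + y) mod N = ((c + x) mod N + j) mod N \<or> (c + x) mod N = ((c + y) mod N + j) mod N"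
    by (auto simp: mod_simps add.assoc)
  then show ?thesis using j(1) by (auto simp: circulant_def)
qed

lemma inj_on_rotate: "inj_on (\<lambda>i. (c + i) mod N) {..<N :: nat}"
proof (rule inj_onI)
  have eq: "x = y" if "x \<le> y" "y < N" "(c + y) mod N = (c + x) mod N" for x y
  proof -
    have "N dvd (c + y) - (c + x)" using that by (subst mod_eq_dvd_iff_nat[symmetric]) auto
    then show ?thesis using that by (auto dest: dvd_imp_le)
  qed
  fix x y assume "x \<in> {..<N}" "y \<in> {..<N}" "(c + x) mod N = (c + y) mod N"
  then show "x = y" using eq[of x y] eq[of y x] by (cases "x \<le> y") auto
qed

lemma image_rotate: "(\<lambda>i. (c + i) mod N) ` {..<N :: nat} = {..<N}"
  by (intro endo_inj_surj inj_on_rotate) auto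

text \<open>Only gaps in the linear order of \<open>{..<N}\<close> matter: the gap that wraps around
  from the largest to the smallest element may be arbitrarily long.\<close>

lemma matchable_circulant_if_no_gap:
  assumes "W \<subseteq> {..<N}" and "even (card W)" and "{1..k} \<subseteq> J"
    and "\<And>x y. x \<in> W \<Longrightarrow> y \<in> W \<Longrightarrow> x < y \<Longrightarrow> W \<inter> {x<..<y} = {} \<Longrightarrow> y - x \<le> k"
  shows "matchable (circulant N J) W"
proof (rule matchable_if_consecutive_adjacent)
  show "finite W" using assms(1) finite_subset by auto
  fix x y assume xy: "x \<in> W" "y \<in> W" "x < y" "W \<inter> {x<..<y} = {}"
  then have "y - x \<in> J" using assms(3) assms(4)[OF xy] by auto
  then show "circulant N J x y" using xy assms(1) by (intro circulant_if_diff) auto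
qed (use assms in auto)

text \<open>If some \<open>k\<close> consecutive vertices have been deleted, rotate so that they become the last ones.\<close>

lemma matchable_circulant_rotate:
  assumes W: "W \<subseteq> {..<N}" "even (card W)" and k: "{1..k} \<subseteq> J"
    and end_deleted: "\<And>W'. W' \<subseteq> {..<N - k} \<Longrightarrow> card W' = card W \<Longrightarrow> matchable (circulant N J) W'"
  shows "matchable (circulant N J) W"
proof (cases "\<forall>x\<in>W. \<forall>y\<in>W. x < y \<and> W \<inter> {x<..<y} = {} \<longrightarrow> y - x \<le> k")
  case True
  then show ?thesis using assms by (intro matchable_circulant_if_no_gap[of W N k]) auto
next
  case False
  then obtain x y where xy: "x \<in> W" "y \<in> W" "x < y" "W \<inter> {x<..<y} = {}" "k < y - x"
    by auto
  have yN: "y < N" using xy W by auto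
  \<comment> \<open>The last \<open>k\<close> indices \<open>N - k\<close>, ...,
    \<open>N - 1\<close> are sent to \<open>x + 1\<close>, ..., \<open>x + k\<close>, which lie
    strictly between \<open>x\<close> and \<open>y\<close> and so outside \<open>W\<close>.\<close>
  define f where "f i = (x + k + 1 + i) mod N" for i
  have inj: "inj_on f {..<N}" and im: "f ` {..<N} = {..<N}"
    unfolding f_def by (rule inj_on_rotate image_rotate)+
  define W' where "W' = {i \<in> {..<N}. f i \<in> W}"
  have W': "f ` W' = W" using im W by (auto simp: W'_def)
  have inj': "inj_on f W'" using inj by (rule inj_on_subset) (auto simp: W'_def)
  have "W' \<subseteq> {..<N - k}"
  proof
    fix i assume i: "i \<in> W'"
    show "i \<in> {..<N - k}"
    proof (rule ccontr)
      assume "i \<notin> {..<N - k}"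
      then have iN: "N - k \<le> i" "i < N" using i by (auto simp: W'_def)
      define t where "t = x + k + 1 + i - N"
      have t: "x + k + 1 + i = t + N" "x < t" "t \<le> x + k" using iN yN xy by (auto simp: t_def)
      then have "f i = t" using yN xy by (simp add: f_def)
      then show False using i t xy by (auto simp: W'_def)
    qed
  qed
  moreover have "card W' = card W" using W' card_image[OF inj'] by simp
  ultimately have "matchable (circulant N J) (f ` W')"
    by (intro matchable_image[OF end_deleted inj']) (simp_all only: f_def circulant_rotate)
  then show ?thesis by (simp add: W')
qed

text \<open>Compared with the known size of \<open>W\<close>, this count of the places outside a gap
  either excludes a long gap or forces \<open>W\<close> to fill all of them.\<close>

lemma card_le_if_gap:
  fixes W :: "nat set"
  assumes "W \<subseteq> {..<m}" and "x \<in> W" and "y \<in> W" and "x < y" and "W \<inter> {x<..<y} = {}"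
  shows "W \<subseteq> {..x} \<union> {y..<m}" and "card ({..x} \<union> {y..<m}) = x + 1 + (m - y)"
proof -
  show "W \<subseteq> {..x} \<union> {y..<m}"
  proof
    fix z assume "z \<in> W"
    then show "z \<in> {..x} \<union> {y..<m}" using assms(1,5) by (cases "z \<le> x"; cases "y \<le> z") auto
  qed
  show "card ({..x} \<union> {y..<m}) = x + 1 + (m - y)"
    using assms(4) by (subst card_Un_disjoint) auto
qed

text \<open>Once \<open>k\<close> of the \<open>2 * k - 1\<close> missing vertices are the last
  ones, only \<open>k - 1\<close> others are missing, too few for a step longer than
  \<open>k\<close>.\<close>

lemma matchable_circulant_odd:
  assumes "1 \<le> k" and "W \<subseteq> {..<N}" and "even (card W)" and "card W + (2 * k - 1) = N"
  shows "matchable (circulant N {1..k}) W"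
proof (rule matchable_circulant_rotate[where k = k])
  fix W' assume W': "W' \<subseteq> {..<N - k}" "card W' = card W"
  show "matchable (circulant N {1..k}) W'"
  proof (rule matchable_circulant_if_no_gap[where k = k])
    fix x y assume xy: "x \<in> W'" "y \<in> W'" "x < y" "W' \<inter> {x<..<y} = {}"
    note g = card_le_if_gap[OF W'(1) xy]
    have "card W' \<le> x + 1 + (N - k - y)" using card_mono[OF _ g(1)] g(2) by simp
    moreover have "y < N - k" using xy W' by auto
    ultimately show "y - x \<le> k" using W'(2) assms(1,4) by linarith
  qed (use assms W' in auto)
qed (use assms in auto)

text \<open>
  The only obstruction is the deletion of two separate blocks of \<open>k\<close> consecutive vertices leaving
  two odd intervals; then some diameter joins them, and each interval without its end point of the
  diameter is still traversed by steps of length at most \<open>2 \<le> k\<close>.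
\<close>

lemma matchable_circulant_even:
  assumes k: "2 \<le> k" and N: "N = 2 * h" and W: "W \<subseteq> {..<N}" "card W + 2 * k = N"
  shows "matchable (circulant N (insert h {1..k})) W"
proof (rule matchable_circulant_rotate[where k = k])
  let ?J = "insert h {1..k}"
  show "even (card W)" using W(2) N by presburger
  fix W' assume W': "W' \<subseteq> {..<N - k}" "card W' = card W"
  have ev: "even (card W')" using W(2) W'(2) N by presburger
  show "matchable (circulant N ?J) W'"
  proof (cases "\<forall>x\<in>W'. \<forall>y\<in>W'. x < y \<and> W' \<inter> {x<..<y} = {} \<longrightarrow> y - x \<le> k")
    case True
    then show ?thesis using W' ev by (intro matchable_circulant_if_no_gap[of _ _ k]) auto
  next
    case False
    then obtain x y where xy: "x \<in> W'" "y \<in> W'" "x < y" "W' \<inter> {x<..<y} = {}" "k < y - x"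
      by auto
    note g = card_le_if_gap[OF W'(1) xy(1-4)]
    have yN: "y < N - k" using xy W' by auto
    have le: "card W' \<le> x + 1 + (N - k - y)" using card_mono[OF _ g(1)] g(2) by simp
    \<comment> \<open>Besides the last \<open>k\<close> vertices exactly \<open>k\<close> others are
      missing; they must all lie in this gap and fill it, so \<open>W'\<close> consists of two full
      intervals.\<close>
    have y: "y = x + k + 1" using le yN W(2) W'(2) xy(5) by linarith
    have W'_eq: "W' = {..x} \<union> {y..<N - k}"
      using g(1) g(2) W'(2) W(2) y yN by (intro card_subset_eq) auto
    have par: "even (x + 1 + (N - k - y))" using ev g(2) W'_eq by simp
    \<comment> \<open>A value of \<open>c\<close> outside the interval removes nothing, so one
      statement serves both parity cases.\<close>
    have interval: "matchable (circulant N ?J) ({a..<b} - {c})"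
      if "b \<le> N" "even (card ({a..<b} - {c}))" for a b c
    proof (rule matchable_circulant_if_no_gap[where k = k])
      fix u v assume uv: "u \<in> {a..<b} - {c}" "v \<in> {a..<b} - {c}" "u < v"
        "({a..<b} - {c}) \<inter> {u<..<v} = {}"
      have "v \<le> u + 2"
      proof (rule ccontr)
        assume "\<not> v \<le> u + 2"
        then have "u + 1 \<in> {a..<b} \<inter> {u<..<v}" "u + 2 \<in> {a..<b} \<inter> {u<..<v}" using uv by auto
        then have "u + 1 = c" "u + 2 = c" using uv(4) by blast+
        then show False by simp
      qed
      then show "v - u \<le> k" using k by simp
    qed (use that in auto)
    show ?thesis
    proof (cases "odd x")
      case True
      have "W' = ({0..<x + 1} - {x + 1}) \<union> ({y..<N - k} - {N})"
        using W'_eq yN by auto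
      moreover have "matchable (circulant N ?J) \<dots>"
      proof (intro matchable_Un interval)
        show "even (card ({0..<x + 1} - {x + 1}))" using True by simp
        have "even (N - k - y)" using True par by presburger
        moreover have "{y..<N - k} - {N} = {y..<N - k}" by auto
        ultimately show "even (card ({y..<N - k} - {N}))" by (simp del: even_diff_nat)
      qed (use yN y in auto)
      ultimately show ?thesis by simp
    next
      case even_x: False
      \<comment> \<open>The least \<open>i\<close> with \<open>y \<le> i + h\<close>. Since
        \<open>k < h\<close>, this \<open>i\<close> lies in the first interval and its antipode
        \<open>i + h\<close> in the second.\<close>
      define i where "i = (if y \<le> h then 0 else y - h)"
      have i: "i \<le> x" "y \<le> i + h" "i + h < N - k"
        using y yN N k by (auto simp: i_def)
      have "W' = {i, i + h} \<union> (({0..<x + 1} - {i}) \<union> ({y..<N - k} - {i + h}))"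
        using W'_eq i y by auto
      moreover have "matchable (circulant N ?J) \<dots>"
      proof (intro matchable_Un interval)
        show "matchable (circulant N ?J) {i, i + h}"
          using i N yN by (intro matchable_pair circulant_if_diff) auto
        show "even (card ({0..<x + 1} - {i}))" using even_x i by simp
        have "even (N - k - y - 1)" using even_x par by presburger
        moreover have "card ({y..<N - k} - {i + h}) = N - k - y - 1"
          using i by (simp add: card_Diff_singleton)
        ultimately show "even (card ({y..<N - k} - {i + h}))" by metis
      qed (use i y yN in auto)
      ultimately show ?thesis by simp
    qed
  qed
qed (use assms in auto)

section \<open>Cubic bicritical graphs\<close>

text \<open>
  The Harary graph of degree three is bipartite on \<open>4 l + 2\<close> vertices and hence not bicritical. In
  the graph below the chords \<open>{x, - x}\<close> join residues of the same parity, so that after the deletion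
  of \<open>u\<close> and \<open>v\<close> of equal parity some chord cuts both odd arcs into even pieces, unless
  \<open>v = - u\<close> or \<open>{u, v} = {0, h}\<close>; in these cases the chords themselves form a perfect matching.
\<close>

definition staircase :: "nat \<Rightarrow> nat \<Rightarrow> nat \<Rightarrow> bool" where
  "staircase h x y \<longleftrightarrow> circulant (2 * h) {1} x y \<or> x + y = 2 * h \<or> {x, y} = {0, h}"

lemma matchable_staircase_interval:
  assumes "b \<le> 2 * h" and "even (b - a)"
  shows "matchable (staircase h) {a..<b}"
proof (rule matchable_if_consecutive_adjacent)
  fix x y assume xy: "x \<in> {a..<b}" "y \<in> {a..<b}" "x < y" "{a..<b} \<inter> {x<..<y} = {}"
  have "y = x + 1"
  proof (rule ccontr)
    assume "y \<noteq> x + 1"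
    then have "x + 1 \<in> {a..<b} \<inter> {x<..<y}" using xy(1-3) by auto
    then show False using xy(4) by blast
  qed
  then show "staircase h x y" using xy(1,2) assms by (auto simp: staircase_def circulant_def)
qed (use assms in auto)

text \<open>The two intervals form a single arc of the cycle through \<open>0\<close>. If both are
  odd, the cycle edge between \<open>2 * h - 1\<close> and \<open>0\<close> joins them and leaves
  two even intervals.\<close>

lemma matchable_staircase_around:
  assumes "a \<le> b" and "b \<le> 2 * h" and "even (a + b)"
  shows "matchable (staircase h) ({0..<a} \<union> {b..<2 * h})"
proof (cases "even a")
  case True
  then show ?thesis using assms
    by (intro matchable_Un matchable_staircase_interval) auto
next
  case False
  have "odd b" using False assms(3) by simp
  then have b: "b < 2 * h" using assms(2) by (metis dvd_triv_left le_neq_implies_less)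
  have a: "0 < a" using False by (metis even_zero gr0I)
  have "{0..<a} \<union> {b..<2 * h} = {0, 2 * h - 1} \<union> ({1..<a} \<union> {b..<2 * h - 1})"
    using a b by auto
  moreover have "matchable (staircase h) \<dots>"
  proof (intro matchable_Un matchable_staircase_interval matchable_pair)
    show "staircase h 0 (2 * h - 1)" using b by (auto simp: staircase_def circulant_def)
    show "even (a - 1)" using False by simp
    show "even (2 * h - 1 - b)" using \<open>odd b\<close> b by presburger
  qed (use a b assms False \<open>odd b\<close> in auto)
  ultimately show ?thesis by simp
qed

text \<open>Deleting \<open>u\<close> and \<open>v\<close> of equal parity leaves two odd arcs. An
  edge from one arc to the other, with both ends of the opposite parity, splits each arc into two
  even pieces.\<close>

lemma matchable_staircase_crossing:
  assumes uxv: "u < x" "x < v" and v: "v < 2 * h" and y: "y < u \<or> v < y" "y < 2 * h"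
    and par: "even (u + v)" "odd (u + x)" "odd (u + y)" and "staircase h x y"
  shows "matchable (staircase h) ({..<2 * h} - {u, v})"
  using y(1)
proof
  assume "v < y"
  then have "{..<2 * h} - {u, v} =
      {x, y} \<union> ({u + 1..<x} \<union> ({x + 1..<v} \<union> ({v + 1..<y} \<union> ({0..<u} \<union> {y + 1..<2 * h}))))"
    using uxv v y by auto
  moreover have "matchable (staircase h) \<dots>"
  proof (intro matchable_staircase_around matchable_Un[OF matchable_pair]
      matchable_Un[OF matchable_staircase_interval])
    show "even (x - (u + 1))" "even (v - (x + 1))" "even (y - (v + 1))" "even (u + (y + 1))"
      using par uxv \<open>v < y\<close> by presburger+
  qed (use uxv v y \<open>v < y\<close> assms(9) in auto)
  ultimately show ?thesis by simp
next
  assume "y < u"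
  then have "{..<2 * h} - {u, v} =
      {x, y} \<union> ({u + 1..<x} \<union> ({x + 1..<v} \<union> ({y + 1..<u} \<union> ({0..<y} \<union> {v + 1..<2 * h}))))"
    using uxv v y by auto
  moreover have "matchable (staircase h) \<dots>"
  proof (intro matchable_staircase_around matchable_Un[OF matchable_pair]
      matchable_Un[OF matchable_staircase_interval])
    show "even (x - (u + 1))" "even (v - (x + 1))" "even (u - (y + 1))" "even (y + (v + 1))"
      using par uxv \<open>y < u\<close> by presburger+
  qed (use uxv v y \<open>y < u\<close> assms(9) in auto)
  ultimately show ?thesis by simp
qed

text \<open>The chords alone match a set that is closed under reflection; the bounds on
  \<open>I\<close> keep away from the fixed points \<open>0\<close> and \<open>h\<close>.\<close>

lemma matchable_staircase_reflection:
  assumes "I \<subseteq> {1..<h}"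
  shows "matchable (staircase h) (I \<union> (\<lambda>i. 2 * h - i) ` I)"
proof (rule matchable_pairing)
  show "finite I" using assms finite_subset by auto
  show "staircase h i (2 * h - i)" if "i \<in> I" for i
    using that assms by (auto simp: staircase_def)
  show "inj_on (\<lambda>i. 2 * h - i) I"
  proof (rule inj_onI)
    fix x y assume "x \<in> I" "y \<in> I" "2 * h - x = 2 * h - y"
    moreover from this have "x < h" "y < h" using assms by auto
    ultimately show "x = y" by linarith
  qed
  show "I \<inter> (\<lambda>i. 2 * h - i) ` I = {}"
  proof -
    have "i \<noteq> 2 * h - j" if "i \<in> I" "j \<in> I" for i j
    proof -
      have "i < h" "j < h" using that assms by auto
      then show ?thesis by linarith
    qed
    then show ?thesis by blast
  qed
qed

lemma image_reflection:
  fixes h :: nat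
  shows "z \<in> (\<lambda>i. 2 * h - i) ` I \<longleftrightarrow> (\<exists>i\<in>I. z = 2 * h - i)"
  by auto

lemma matchable_staircase:
  assumes uv: "u < v" "v < 2 * h"
  shows "matchable (staircase h) ({..<2 * h} - {u, v})"
proof -
  consider (odd) "odd (u + v)"
    | (poles) "u = 0" "v = h"
    | (mirror) "0 < u" "u + v = 2 * h"
    | (generic) "even (u + v)" "\<not> (u = 0 \<and> v = h)" "u + v \<noteq> 2 * h"
    using uv by fastforce
  then show ?thesis
  proof cases
    case odd
    \<comment> \<open>Both arcs between vertices of different parity are even, so edges of the cycle
      suffice.\<close>
    have "{..<2 * h} - {u, v} = {u + 1..<v} \<union> ({0..<u} \<union> {v + 1..<2 * h})" using uv by auto
    moreover have "matchable (staircase h) \<dots>"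
      using uv odd
      by (intro matchable_Un matchable_staircase_interval matchable_staircase_around) auto
    ultimately show ?thesis by simp
  next
    case poles
    have "{..<2 * h} - {u, v} = {1..<h} \<union> (\<lambda>i. 2 * h - i) ` {1..<h}"
    proof (rule set_eqI)
      fix z
      have "h < z \<Longrightarrow> z < 2 * h \<Longrightarrow> z = 2 * h - (2 * h - z) \<and> 2 * h - z \<in> {1..<h}" by auto
      then show "z \<in> {..<2 * h} - {u, v} \<longleftrightarrow> z \<in> {1..<h} \<union> (\<lambda>i. 2 * h - i) ` {1..<h}"
        unfolding Un_iff image_reflection using poles by (cases "h < z") fastforce+
    qed
    then show ?thesis using matchable_staircase_reflection[of "{1..<h}" h] by simp
  next
    case mirror
    let ?I = "{1..<h} - {u}"
    have u: "u < h" "v = 2 * h - u" using mirror uv by auto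
    \<comment> \<open>Deleting \<open>u\<close> and \<open>v\<close> removes exactly one chord; the
      other chords miss only \<open>0\<close> and \<open>h\<close>, which are adjacent.\<close>
    have "{..<2 * h} - {u, v} = {0, h} \<union> (?I \<union> (\<lambda>i. 2 * h - i) ` ?I)"
    proof (rule set_eqI)
      fix z
      have "h < z \<Longrightarrow> z < 2 * h \<Longrightarrow> z \<noteq> v \<Longrightarrow> z = 2 * h - (2 * h - z) \<and> 2 * h - z \<in> ?I"
        using u by auto
      then show "z \<in> {..<2 * h} - {u, v} \<longleftrightarrow> z \<in> {0, h} \<union> (?I \<union> (\<lambda>i. 2 * h - i) ` ?I)"
        unfolding Un_iff image_reflection using u mirror by (cases "h < z") fastforce+
    qed
    moreover have "matchable (staircase h) \<dots>"
    proof (intro matchable_Un[OF matchable_pair] matchable_staircase_reflection)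
      show "{0, h} \<inter> (?I \<union> (\<lambda>i. 2 * h - i) ` ?I) = {}" by fastforce
    qed (use u in \<open>auto simp: staircase_def\<close>)
    ultimately show ?thesis by simp
  next
    case generic
    have gap: "u + 2 \<le> v" using uv generic(1) by presburger
    have "\<exists>x y. u < x \<and> x < v \<and> (y < u \<or> v < y) \<and> y < 2 * h \<and>
        x + y = 2 * h \<and> (odd (u + x) \<or> odd (u + y))"
    proof -
      \<comment> \<open>One end of the chord is always a cycle neighbour of \<open>u\<close> or
        \<open>v\<close>, hence of the right parity. The cases select a neighbour whose mirror image
        lies in the other arc.\<close>
      consider "u = 0" "v < h" | "u = 0" "h < v" | "0 < u" "u + v < 2 * h"
        | "0 < u" "2 * h < u + v" "u \<le> h" | "h < u"
        using generic by linarith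
      then show ?thesis
      proof cases
        case 1
        then have "odd (u + (v - 1))" using generic(1) gap by simp
        then show ?thesis using 1 gap
          by (intro exI[of _ "v - 1"] exI[of _ "2 * h - (v - 1)"]) auto
      next
        case 2
        then have "odd (u + (v + 1))" using generic(1) by simp
        moreover have "2 * h - (v + 1) > 0" using uv(2) generic(1) 2 by presburger
        ultimately show ?thesis using 2 gap
          by (intro exI[of _ "2 * h - (v + 1)"] exI[of _ "v + 1"]) auto
      next
        case 3
        have "u + v + 2 \<le> 2 * h" using 3(2) generic(1) by presburger
        then show ?thesis using 3 gap
          by (intro exI[of _ "u + 1"] exI[of _ "2 * h - (u + 1)"]) auto
      next
        case 4
        have "2 * h + 2 \<le> u + v" using 4(2) generic(1) by presburger
        moreover have "odd (u + (u - 1))" using 4(1) by presburger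
        ultimately show ?thesis using 4 uv
          by (intro exI[of _ "2 * h - (u - 1)"] exI[of _ "u - 1"]) auto
      next
        case 5
        then show ?thesis using uv gap
          by (intro exI[of _ "u + 1"] exI[of _ "2 * h - (u + 1)"]) auto
      qed
    qed
    then obtain x y where xy: "u < x" "x < v" "y < u \<or> v < y" "y < 2 * h"
      "x + y = 2 * h" "odd (u + x) \<or> odd (u + y)" by blast
    \<comment> \<open>The ends of a chord have equal parity, so one odd sum yields the
      other.\<close>
    have "even (x + y)" using xy(5) by simp
    then have "odd (u + x)" "odd (u + y)" using xy(6) by auto
    then show ?thesis using xy(1-5) uv(2) generic(1)
      by (intro matchable_staircase_crossing[of u x v h y]) (simp_all add: staircase_def)
  qed
qed

section \<open>From adjacency relations to graphs\<close>

lemma ex_perfect_matching_if_matchable: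
  assumes "matchable E (verts G)"
    and edge: "\<And>x y. x \<in> verts G \<Longrightarrow> y \<in> verts G \<Longrightarrow> E x y \<Longrightarrow> {x, y} \<in> uedges G"
  shows "\<exists>M. perfect_matching G M"
proof -
  \<comment> \<open>The claim mentions only \<open>E\<close> and \<open>W\<close>, not
    \<open>G\<close>, because the vertex set has to vary during the induction.\<close>
  have "\<exists>M. M \<subseteq> {{x, y} | x y. x \<in> W \<and> y \<in> W \<and> E x y} \<and>
      (\<forall>e\<in>M. \<forall>f\<in>M. e \<noteq> f \<longrightarrow> e \<inter> f = {}) \<and> \<Union>M = W" if "matchable E W" for W
    using that
  proof (induction rule: matchable.induct)
    case empty
    show ?case by (intro exI[of _ "{}"]) auto
  next
    case (insert W x y)
    then obtain M where M: "M \<subseteq> {{x, y} | x y. x \<in> W \<and> y \<in> W \<and> E x y}"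
      "\<forall>e\<in>M. \<forall>f\<in>M. e \<noteq> f \<longrightarrow> e \<inter> f = {}" "\<Union>M = W" by blast
    have new: "e \<inter> {x, y} = {}" if "e \<in> M" for e using that M(3) insert.hyps by auto
    have "insert {x, y} M \<subseteq>
        {{x', y'} | x' y'. x' \<in> insert x (insert y W) \<and> y' \<in> insert x (insert y W) \<and> E x' y'}"
      using M(1) insert.hyps(2) by blast
    moreover have "\<forall>e\<in>insert {x, y} M. \<forall>f\<in>insert {x, y} M. e \<noteq> f \<longrightarrow> e \<inter> f = {}"
      using M(2) new by blast
    moreover have "\<Union>(insert {x, y} M) = insert x (insert y W)" using M(3) by auto
    ultimately show ?case by blast
  qed
  from this[OF assms(1)] obtain M
    where M: "M \<subseteq> {{x, y} | x y. x \<in> verts G \<and> y \<in> verts G \<and> E x y}"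
      "\<forall>e\<in>M. \<forall>f\<in>M. e \<noteq> f \<longrightarrow> e \<inter> f = {}" "\<Union>M = verts G"
    by (elim exE conjE) (rule that)
  have "{{x, y} | x y. x \<in> verts G \<and> y \<in> verts G \<and> E x y} \<subseteq> uedges G"
    using edge by auto
  with M(1) have "M \<subseteq> uedges G" by (rule subset_trans)
  then show ?thesis using M(2,3) unfolding perfect_matching_def by blast
qed

text \<open>The labelling \<open>g\<close> carries a relation on \<open>{..<N}\<close> over to a
  prescribed vertex set of any type.\<close>

definition graph_on :: "nat \<Rightarrow> (nat \<Rightarrow> nat \<Rightarrow> bool) \<Rightarrow> (nat \<Rightarrow> 'a) \<Rightarrow> 'a pair_pre_digraph" where
  "graph_on N E g = \<lparr> pverts = g ` {..<N},
     parcs = {(g x, g y) | x y. x < N \<and> y < N \<and> x \<noteq> y \<and> E x y} \<rparr>"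

lemma graph_on_simps [simp]:
  "pverts (graph_on N E g) = g ` {..<N}"
  "parcs (graph_on N E g) = {(g x, g y) | x y. x < N \<and> y < N \<and> x \<noteq> y \<and> E x y}"
  by (simp_all add: graph_on_def)

lemma pair_graph_graph_on:
  assumes "symp E" and "inj_on g {..<N}"
  shows "pair_graph (graph_on N E g)"
proof unfold_locales
  have "parcs (graph_on N E g) \<subseteq> g ` {..<N} \<times> g ` {..<N}" by auto
  then show "finite (parcs (graph_on N E g))" by (rule finite_subset) auto
  show "Digraph.symmetric (graph_on N E g)"
    unfolding symmetric_def with_proj_simps graph_on_simps
    using sympD[OF assms(1)] by (intro symI) blast
qed (use assms(2) in \<open>auto dest: inj_onD\<close>)

lemma connected_graph_on:
  assumes "symp E" and "inj_on g {..<N}" and "0 < N" and "\<And>i. Suc i < N \<Longrightarrow> E i (Suc i)"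
  shows "Digraph_Component.connected (graph_on N E g)"
proof -
  let ?G = "graph_on N E g"
  interpret pair_graph ?G by (rule pair_graph_graph_on) fact+
  have reach: "g 0 \<rightarrow>\<^sup>*\<^bsub>?G\<^esub> g i" if "i < N" for i
    using that
  proof (induction i)
    case 0
    then show ?case by auto
  next
    case (Suc i)
    have "(g i, g (Suc i)) \<in> parcs ?G" using Suc.prems assms(4)[of i] by fastforce
    from reachable_adj_trans[OF _ this] show ?case using Suc by simp
  qed
  show ?thesis
  proof (rule connectedI)
    show "pverts ?G \<noteq> {}" using assms(3) by auto
    fix u v assume "u \<in> pverts ?G" "v \<in> pverts ?G"
    then have "g 0 \<rightarrow>\<^sup>*\<^bsub>?G\<^esub> u" "g 0 \<rightarrow>\<^sup>*\<^bsub>?G\<^esub> v" using reach by auto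
    then show "u \<rightarrow>\<^sup>*\<^bsub>mk_symmetric ?G\<^esub> v"
      using symmetric_reachable' reachable_trans reachable_mk_symmetricI by blast
  qed
qed

lemma factor_critical_graph_on:
  assumes "symp E" and inj: "inj_on g {..<N}" and "n + 2 \<le> N"
    and "\<And>i. Suc i < N \<Longrightarrow> E i (Suc i)"
    and match: "\<And>W. W \<subseteq> {..<N} \<Longrightarrow> card W + n = N \<Longrightarrow> matchable E W"
  shows "factor_critical n (graph_on N E g)"
  unfolding factor_critical_def
proof (intro conjI allI impI)
  let ?G = "graph_on N E g"
  interpret pair_graph ?G by (rule pair_graph_graph_on) fact+
  show "graph ?G" by unfold_locales
  show "Digraph_Component.connected ?G" using assms by (intro connected_graph_on) auto
  show "n + 2 \<le> card (verts ?G)" using assms(3) inj by (simp add: card_image)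
  fix S assume S: "S \<subseteq> verts ?G \<and> card S = n"
  let ?H = "?G \<restriction> (verts ?G - S)"
  define W where "W = {x \<in> {..<N}. g x \<notin> S}"
  have gW: "g ` W = verts ?G - S" by (auto simp: W_def)
  have injW: "inj_on g W" using inj by (rule inj_on_subset) (auto simp: W_def)
  have fin: "finite (verts ?G)" by simp
  have "card W = N - n"
    using card_image[OF injW] gW S card_Diff_subset[of S "verts ?G"] finite_subset[OF _ fin]
      card_image[OF inj] by simp
  then have "matchable E W" using assms(3) by (intro match) (auto simp: W_def)
  then have "matchable (\<lambda>a b. (a, b) \<in> parcs ?G) (g ` W)"
    using injW by (rule matchable_image) (auto simp: W_def)
  then show "\<exists>M. perfect_matching ?H M"
  proof (intro ex_perfect_matching_if_matchable)
    fix a b assume "a \<in> verts ?H" "b \<in> verts ?H" "(a, b) \<in> parcs ?G"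
    then show "{a, b} \<in> uedges ?H"
      unfolding uedges_def by (auto simp: induce_subgraph_def)
  qed (simp add: gW)
qed

text \<open>An upper bound is enough, as the degree bound supplies the converse; coincidences among
  the listed edges need not be excluded.\<close>

lemma card_uedges_graph_on_le:
  assumes "\<And>x y. x < N \<Longrightarrow> y < N \<Longrightarrow> x \<noteq> y \<Longrightarrow> E x y \<Longrightarrow> {x, y} \<in> F" and "finite F"
  shows "card (uedges (graph_on N E g)) \<le> card F"
proof -
  have "uedges (graph_on N E g) \<subseteq> (`) g ` F"
  proof
    fix e assume "e \<in> uedges (graph_on N E g)"
    then obtain x y where "e = {g x, g y}" "x < N" "y < N" "x \<noteq> y" "E x y"
      by (auto simp: uedges_def)
    moreover from this have "{x, y} \<in> F" using assms(1) by blast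
    ultimately show "e \<in> (`) g ` F" by (intro image_eqI[of _ _ "{x, y}"]) auto
  qed
  then show ?thesis using assms(2) by (meson card_image_le card_mono finite_imageI le_trans)
qed

section \<open>The degree bound\<close>

text \<open>Arcs are counted by fibres over undirected edges; each fibre contains at most the two
  orientations.\<close>

lemma (in pair_graph) card_parcs_le_card_uedges: "card (parcs G) \<le> 2 * card (uedges G)"
proof -
  let ?f = "\<lambda>a. {fst a, snd a}"
  have U: "uedges G = ?f ` parcs G"
    unfolding uedges_def with_proj_simps by (rule Setcompr_eq_image)
  have "card (parcs G) = (\<Sum>e\<in>uedges G. card {a \<in> parcs G. ?f a = e})"
    using sum.image_gen[OF finite_arcs, of "\<lambda>_. 1 :: nat" ?f] by (simp add: U)
  also have "\<dots> \<le> (\<Sum>e\<in>uedges G. 2)"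
  proof (rule sum_mono)
    fix e assume "e \<in> uedges G"
    then obtain u v where e: "e = {u, v}" by (auto simp: uedges_def)
    have "{a \<in> parcs G. ?f a = e} \<subseteq> {(u, v), (v, u)}" by (auto simp: e doubleton_eq_iff)
    moreover have "card {(u, v), (v, u)} \<le> 2" by (intro card_insert_le_m1) auto
    ultimately show "card {a \<in> parcs G. ?f a = e} \<le> 2"
      by (meson card_mono finite.emptyI finite.insertI le_trans)
  qed
  finally show ?thesis by simp
qed

lemma out_degree_if_factor_critical:
  fixes G :: "'a pair_pre_digraph"
  assumes fc: "factor_critical n G" and v: "v \<in> pverts G"
  shows "n + 1 \<le> out_degree G v"
proof (rule ccontr)
  interpret graph G using fc by (simp add: factor_critical_def)
  define A where "A = snd ` out_arcs G v"
  assume "\<not> n + 1 \<le> out_degree G v"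
  then have "card A \<le> n"
    using card_image_le[OF finite_out_arcs, of snd v] by (simp add: A_def out_degree_def)
  moreover have A: "A \<subseteq> pverts G - {v}"
    using head_in_verts no_loops by (fastforce simp: A_def out_arcs_def)
  moreover have "n \<le> card (pverts G - {v})"
  proof -
    have "n + 2 \<le> card (pverts G)" using fc by (simp add: factor_critical_def)
    then show ?thesis using v by simp
  qed
  moreover have "finite (pverts G - {v})" using finite_verts by simp
  \<comment> \<open>The neighbourhood of \<open>v\<close> is padded to exactly \<open>n\<close>
    vertices other than \<open>v\<close>; deleting them isolates \<open>v\<close>.\<close>
  ultimately obtain S where S: "A \<subseteq> S" "S \<subseteq> pverts G - {v}" "card S = n"
    using exists_subset_between by metis
  let ?H = "G \<restriction> (verts G - S)"
  obtain M where M: "perfect_matching ?H M"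
    using fc S unfolding factor_critical_def by (metis Diff_subset subset_trans with_proj_simps(1))
  have "v \<in> verts ?H" using S v by auto
  then obtain e where e: "e \<in> uedges ?H" "v \<in> e"
    using M unfolding perfect_matching_def by blast
  then obtain a where a: "a \<in> parcs G" "fst a \<notin> S" "snd a \<notin> S" "v = fst a \<or> v = snd a"
    by (auto simp: uedges_def induce_subgraph_def)
  \<comment> \<open>The arc behind the matching edge may point towards \<open>v\<close>; symmetry
    then provides the reverse arc.\<close>
  have "\<exists>w. w \<notin> S \<and> (v, w) \<in> parcs G"
  proof (cases "v = fst a")
    case True
    then show ?thesis using a by (metis prod.collapse)
  next
    case False
    have "(snd a, fst a) \<in> parcs G" using graph_symmetric[of "fst a" "snd a"] a(1) by simp
    then show ?thesis using a False by metis
  qed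
  then obtain w where w: "w \<notin> S" "(v, w) \<in> parcs G" by blast
  then have "w \<in> A" unfolding A_def out_arcs_def by (intro image_eqI[of _ _ "(v, w)"]) auto
  then show False using S(1) w(1) by blast
qed

text \<open>Handshake argument: the sets \<open>out_arcs G v\<close> partition the arcs by their
  tails.\<close>

lemma card_uedges_if_factor_critical:
  fixes G :: "'a pair_pre_digraph"
  assumes fc: "factor_critical n G"
  shows "card (pverts G) * (n + 1) \<le> 2 * card (uedges G)"
proof -
  interpret pair_graph G using fc by (intro pair_graphI_graph) (simp add: factor_critical_def)
  have "card (pverts G) * (n + 1) = (\<Sum>v\<in>pverts G. n + 1)" by simp
  also have "\<dots> \<le> (\<Sum>v\<in>pverts G. out_degree G v)"
    using out_degree_if_factor_critical[OF fc] by (intro sum_mono) auto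
  also have "\<dots> = card (\<Union>v\<in>pverts G. out_arcs G v)"
    unfolding out_degree_def by (rule card_UN_disjoint[symmetric]) (auto simp: out_arcs_def)
  also have "(\<Union>v\<in>pverts G. out_arcs G v) = parcs G"
    by (auto simp: out_arcs_def in_arcsD1)
  also have "card (parcs G) \<le> 2 * card (uedges G)" by (rule card_parcs_le_card_uedges)
  finally show ?thesis .
qed

section \<open>Extremal graphs\<close>

lemma symp_circulant: "symp (circulant N J)"
  by (auto simp: symp_def circulant_def)

lemma symp_staircase: "symp (staircase h)"
  using sympD[OF symp_circulant] by (auto simp: symp_def staircase_def insert_commute)

lemma circulant_Suc: "Suc i < N \<Longrightarrow> 1 \<in> J \<Longrightarrow> circulant N J i (Suc i)"
  by (rule circulant_if_diff) auto

lemma circulant_edges: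
  assumes "x < N" and "y < N" and "circulant N J x y"
  shows "{x, y} \<in> (\<lambda>(x, j). {x, (x + j) mod N}) ` ({..<N} \<times> J)"
proof -
  have edge: "{x, (x + j) mod N} \<in> (\<lambda>(x, j). {x, (x + j) mod N}) ` ({..<N} \<times> J)"
    if "x < N" "j \<in> J" for x j
    using that by (intro image_eqI[of _ _ "(x, j)"]) auto
  obtain j where j: "j \<in> J" "y = (x + j) mod N \<or> x = (y + j) mod N"
    using assms(3) by (auto simp only: circulant_def)
  from j(2) show ?thesis
  proof
    assume "y = (x + j) mod N"
    then show ?thesis using edge[OF assms(1) j(1)] by (simp only:)
  next
    assume "x = (y + j) mod N"
    then have "{y, x} \<in> (\<lambda>(x, j). {x, (x + j) mod N}) ` ({..<N} \<times> J)"
      using edge[OF assms(2) j(1)] by (simp only:)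
    then show ?thesis by (simp only: insert_commute[of x y])
  qed
qed

text \<open>The jump \<open>h\<close> from \<open>x\<close> and from \<open>x + h\<close> gives the
  same edge, so the diameters contribute only \<open>h\<close> edges instead of
  \<open>2 * h\<close>.\<close>

lemma circulant_diameter_edges:
  assumes "x < 2 * h" and "y < 2 * h" and "circulant (2 * h) (insert h J) x y"
  shows "{x, y} \<in> (\<lambda>(x, j). {x, (x + j) mod (2 * h)}) ` ({..<2 * h} \<times> J) \<union>
    (\<lambda>x. {x, x + h}) ` {..<h}" (is "_ \<in> ?A \<union> ?B")
proof -
  have diam: "{x, (x + h) mod (2 * h)} \<in> ?B" if "x < 2 * h" for x
  proof (cases "x < h")
    case False
    then have "x + h = (x - h) + 2 * h" by simp
    then have "(x + h) mod (2 * h) = x - h"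
      using that by (metis less_imp_diff_less mod_add_self2 mod_less)
    then show ?thesis using False that by (intro image_eqI[of _ _ "x - h"]) auto
  qed auto
  have "(\<lambda>(x, j). {x, (x + j) mod (2 * h)}) ` ({..<2 * h} \<times> insert h J) \<subseteq> ?A \<union> ?B"
    using diam by (auto simp del: Un_iff)
  then show ?thesis using circulant_edges[OF assms] by (rule subsetD)
qed

text \<open>There are at most \<open>2 * h\<close> cycle edges, \<open>h - 1\<close> chords listed
  by their smaller end, and the edge \<open>{0, h}\<close>: together \<open>3 * h\<close>.\<close>

lemma staircase_edges:
  assumes xy: "x < 2 * h" "y < 2 * h" "x \<noteq> y" "staircase h x y"
  shows "{x, y} \<in> (\<lambda>(x, j). {x, (x + j) mod (2 * h)}) ` ({..<2 * h} \<times> {1}) \<union>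
    insert {0, h} ((\<lambda>x. {x, 2 * h - x}) ` {1..<h})" (is "_ \<in> ?A \<union> insert _ ?B")
proof -
  have chord: "{x, y} \<in> ?B" if "x + y = 2 * h" "x < y" "y < 2 * h" for x y
    using that by (intro image_eqI[of _ _ x]) auto
  show ?thesis
    using xy(4) unfolding staircase_def
  proof (elim disjE)
    assume "circulant (2 * h) {1} x y"
    from circulant_edges[OF xy(1,2) this] show ?thesis by (rule UnI1)
  next
    assume "x + y = 2 * h"
    then have "{x, y} \<in> ?B"
      using chord[of x y] chord[of y x] xy(1-3) insert_commute[of x y "{}"]
      by (cases "x < y") simp_all
    then show ?thesis by blast
  qed simp
qed

lemma card_image_prod_le:
  assumes "finite A" and "finite B"
  shows "card (f ` (A \<times> B)) \<le> card A * card B"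
  using card_image_le[of "A \<times> B" f] assms by (simp add: card_cartesian_product)

text \<open>\<open>F\<close> contains all edges of \<open>E\<close>. The bounds on its size are
  \<open>N * k\<close> for \<open>n = 2 * k - 1\<close>, \<open>3 * h\<close> for
  \<open>n = 2\<close>, and \<open>2 * h * k + h\<close> for \<open>n = 2 * k\<close>, where
  \<open>N = 2 * h\<close> in the last two cases; each equals
  \<open>N * (n + 1) / 2\<close>.\<close>

lemma extremal_relation:
  fixes n N :: nat
  assumes "n \<ge> 1" and "N > n" and "n mod 2 = N mod 2"
  obtains E F where "symp E" and "\<And>i. Suc i < N \<Longrightarrow> E i (Suc i)"
    and "\<And>W. W \<subseteq> {..<N} \<Longrightarrow> card W + n = N \<Longrightarrow> matchable E W"
    and "\<And>x y. x < N \<Longrightarrow> y < N \<Longrightarrow> x \<noteq> y \<Longrightarrow> E x y \<Longrightarrow> {x, y} \<in> F"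
    and "finite F" and "2 * card F \<le> N * (n + 1)"
proof -
  consider (odd) "odd n" | (two) "n = 2" | (even) "even n" "4 \<le> n"
  proof -
    have "odd n \<or> n = 2 \<or> even n \<and> 4 \<le> n" using assms(1) by presburger
    then show ?thesis using that by blast
  qed
  then show thesis
  proof cases
    case odd
    then obtain l where "n = 2 * l + 1" by (elim oddE)
    then obtain k where k: "1 \<le> k" "n = 2 * k - 1" by (intro that[of "l + 1"]) auto
    let ?F = "(\<lambda>(x, j). {x, (x + j) mod N}) ` ({..<N} \<times> {1..k})"
    have "matchable (circulant N {1..k}) W" if W: "W \<subseteq> {..<N}" "card W + n = N" for W
    proof (rule matchable_circulant_odd)
      show "even (card W)" using W(2) assms(3) by presburger
    qed (use k W in auto)
    moreover have "2 * card ?F \<le> N * (n + 1)"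
      using card_image_prod_le[of "{..<N}" "{1..k}"] k by auto
    ultimately show thesis
      using k by (intro that[of "circulant N {1..k}" ?F])
        (simp_all add: symp_circulant circulant_edges circulant_Suc)
  next
    case two
    define h where "h = N div 2"
    have N: "N = 2 * h" using two assms(3) by (simp add: h_def) presburger
    let ?A = "(\<lambda>(x, j). {x, (x + j) mod (2 * h)}) ` ({..<2 * h} \<times> {1})"
    let ?B = "(\<lambda>x. {x, 2 * h - x}) ` {1..<h}"
    let ?F = "?A \<union> insert {0, h} ?B"
    have match: "matchable (staircase h) W" if W: "W \<subseteq> {..<N}" "card W + n = N" for W
    proof -
      have "card ({..<N} - W) = 2"
        using W two card_Diff_subset[OF finite_subset[OF W(1)] W(1)] by auto
      then obtain u v where uv: "{..<N} - W = {u, v}" "u \<noteq> v" by (auto simp: card_2_iff)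
      then have W_eq: "W = {..<2 * h} - {u, v}" using W(1) N by blast
      have "u < 2 * h" "v < 2 * h" using uv(1) N by auto
      then show ?thesis
        using uv(2) matchable_staircase[of u v h] matchable_staircase[of v u h]
        by (cases "u < v") (auto simp: W_eq insert_commute)
    qed
    have card: "card ?F \<le> 3 * h"
    proof -
      have "card ?B \<le> h - 1" using card_image_le[of "{1..<h}"] by auto
      then have "card (insert {0, h} ?B) \<le> h - 1 + 1" by (simp add: card_insert_if)
      moreover have "card ?A \<le> 2 * h"
        using card_image_prod_le[of "{..<2 * h}" "{1 :: nat}"] by auto
      moreover have "card ?F \<le> card ?A + card (insert {0, h} ?B)" by (rule card_Un_le)
      ultimately show ?thesis using N assms(2) by linarith
    qed
    show thesis
    proof (rule that[of "staircase h" ?F])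
      show "staircase h i (Suc i)" if "Suc i < N" for i
        using that N circulant_Suc[of i "2 * h" "{1}"] by (simp add: staircase_def)
      show "{x, y} \<in> ?F" if "x < N" "y < N" "x \<noteq> y" "staircase h x y" for x y
        using that unfolding N by (rule staircase_edges)
      show "2 * card ?F \<le> N * (n + 1)" using card two N by simp
    qed (use match in \<open>simp_all add: symp_staircase\<close>)
  next
    case even
    define h k where "h = N div 2" and "k = n div 2"
    have N: "N = 2 * h" and k: "n = 2 * k" "2 \<le> k"
      using even assms(3) by (simp_all add: h_def k_def) presburger+
    let ?A = "(\<lambda>(x, j). {x, (x + j) mod (2 * h)}) ` ({..<2 * h} \<times> {1..k})"
    let ?B = "(\<lambda>x. {x, x + h}) ` {..<h}"
    let ?E = "circulant (2 * h) (insert h {1..k})"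
    have match: "matchable ?E W" if "W \<subseteq> {..<N}" "card W + n = N" for W
      using that N k by (intro matchable_circulant_even[of k]) auto
    have "card (?A \<union> ?B) \<le> 2 * h * k + h"
      using card_image_prod_le[of "{..<2 * h}" "{1..k}"] card_image_le[of "{..<h}"]
      by (intro le_trans[OF card_Un_le] add_mono) auto
    then have card: "2 * card (?A \<union> ?B) \<le> N * (n + 1)" by (simp add: N k algebra_simps)
    show thesis
    proof (rule that[of ?E "?A \<union> ?B"])
      show "?E i (Suc i)" if "Suc i < N" for i
        using that N k by (intro circulant_Suc) auto
      show "{x, y} \<in> ?A \<union> ?B" if "x < N" "y < N" "?E x y" for x y
        using that unfolding N by (rule circulant_diameter_edges)
    qed (use match card in \<open>simp_all add: symp_circulant\<close>)
  qed
qed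

theorem mainTheorem1:
  fixes n \<nu> :: nat and V :: "'a set"
  assumes "n \<ge> 1" and "\<nu> > n" and "n mod 2 = \<nu> mod 2"
    and "card V = \<nu>"
  shows "(\<exists>G :: 'a pair_pre_digraph. pverts G = V \<and> factor_critical n (with_proj G) \<and>
            real (card (uedges (with_proj G))) = real \<nu> * (real n + 1) / 2) \<and>
         (\<forall>G :: 'a pair_pre_digraph. pverts G = V \<and> factor_critical n (with_proj G) \<longrightarrow>
            real (card (uedges (with_proj G))) \<ge> real \<nu> * (real n + 1) / 2)"
proof -
  have lower: "\<nu> * (n + 1) \<le> 2 * card (uedges G)"
    if "pverts G = V" "factor_critical n G" for G :: "'a pair_pre_digraph"
    using card_uedges_if_factor_critical[OF that(2)] that(1) assms(4) by simp
  have half: "real \<nu> * (real n + 1) / 2 \<le> real m \<longleftrightarrow> \<nu> * (n + 1) \<le> 2 * m"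
    "real m = real \<nu> * (real n + 1) / 2 \<longleftrightarrow> 2 * m = \<nu> * (n + 1)" for m
  proof -
    have "real \<nu> * (real n + 1) = real (\<nu> * (n + 1))" by (simp add: algebra_simps)
    then show "real \<nu> * (real n + 1) / 2 \<le> real m \<longleftrightarrow> \<nu> * (n + 1) \<le> 2 * m"
      "real m = real \<nu> * (real n + 1) / 2 \<longleftrightarrow> 2 * m = \<nu> * (n + 1)"
      by linarith+
  qed
  \<comment> \<open>An infinite set has cardinality \<open>0\<close> by convention, whereas \<nu> is
    positive.\<close>
  have "finite V" using assms by (intro card_ge_0_finite) simp
  then obtain g where g: "bij_betw g {..<\<nu>} V"
    using assms(4) ex_bij_betw_nat_finite by (metis atLeast0LessThan)
  show ?thesis
  proof (rule extremal_relation[OF assms(1-3)])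
    fix E F assume E: "symp E" "\<And>i. Suc i < \<nu> \<Longrightarrow> E i (Suc i)"
      "\<And>W. W \<subseteq> {..<\<nu>} \<Longrightarrow> card W + n = \<nu> \<Longrightarrow> matchable E W"
      "\<And>x y. x < \<nu> \<Longrightarrow> y < \<nu> \<Longrightarrow> x \<noteq> y \<Longrightarrow> E x y \<Longrightarrow> {x, y} \<in> F"
      "finite F" "2 * card F \<le> \<nu> * (n + 1)"
    let ?G = "graph_on \<nu> E g"
    have V: "pverts ?G = V" using g by (simp add: bij_betw_def)
    have "n + 2 \<le> \<nu>" using assms(2,3) by presburger
    then have fc: "factor_critical n ?G"
      using E g by (intro factor_critical_graph_on) (auto simp: bij_betw_def)
    have "card (uedges ?G) \<le> card F" using E(4,5) by (rule card_uedges_graph_on_le)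
    \<comment> \<open>The degree bound, applied to the constructed graph itself, turns the upper
      bound into an equality.\<close>
    then have "2 * card (uedges ?G) = \<nu> * (n + 1)" using lower[OF V fc] E(6) by linarith
    then show ?thesis using V fc lower unfolding half by blast
  qed
qed

end
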